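(* Let $X\neq\{0\}$ be a real Hilbert space, let $m\in\mathbb{N}$, let $I:=\{1,2,\ldots,m\}$, and let $\lambda\in(0,2)$. Let $\mathcal{A}:=(A_i)_{i=1}^m$ be a family of subsets of $X$ such that each $A_i$, $i\in I$, is either a closed half-space or a closed hyperplane. For each $i\in I$ let $\widehat{A}_i$ be the boundary hyperplane of $A_i$ if $A_i$ is a half-space, and $\widehat{A}_i:=A_i$ if $A_i$ is a hyperplane, and let $\widehat{\mathcal{A}}:=(\widehat{A}_i)_{i=1}^m$ (this is an innately regular family of closed affine subspaces, since each $\widehat{A}_i$ is finite co-dimensional). Let $\mu_{\widehat{\mathcal{A}},\lambda}>0$ be the Bauschke-Tung constant associated with $\widehat{\mathcal{A}}$ and $\lambda$ (see context). For each $k\in\mathbb{N}\cup\{0\}$ let $\lambda_k\in[0,\lambda]$, let $c:\mathbb{N}\cup\{0\}\to I$ be an arbitrary function, let $x^0\in X$, and define $$x^{k+1}:=T_k(x^k),\qquad T_k(x):=(1-\lambda_k)x+\lambda_k P_{A_{c(k)}}(x)\quad(x\in X),\qquad k\in\mathbb{N}\cup\{0\}.$$ Then $\|x^k\|\le\|x^0\|+\lambda\mu_{\widehat{\mathcal{A}},\lambda}$ for all $k\in\mathbb{N}\cup\{0\}$.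
   Context: $\mathbb{N}$ denotes the positive integers. For a nonempty closed convex set $C\subseteq X$, $P_C:X\to X$ is the orthogonal (nearest point) projection onto $C$, and $\mathrm{Id}$ is the identity map. For $x\in X$ and $A\subseteq X$, $d(x,A):=\inf\{\|x-a\|\,:\,a\in A\}$. A half-space (respectively, hyperplane) is a set of the form $\{x\in X\,:\,f(x)\le\alpha\}$ (respectively, $\{x\in X\,:\,f(x)=\alpha\}$), where $f:X\to\mathbb{R}$ is a nonzero linear functional and $\alpha\in\mathbb{R}$ (when the set is closed, $f$ is continuous). The boundary hyperplane of the closed half-space $\{f\le\alpha\}$ is $\{f=\alpha\}$. An affine subspace is a set $A=p_A+\widetilde{A}$ with $p_A\in X$ and $\widetilde{A}$ a linear subspace of $X$ (the associated linear subspace). A finite family $(L_i)_{i\in J}$ of closed linear subspaces is regular if there is $\eta>0$ such that $d(x,\bigcap_{i\in J}L_i)\le\eta\max\{d(x,L_i)\,:\,i\in J\}$ for all $x\in X$; it is innately regular if every nonempty subfamily of it is regular. A finite family of closed affine subspaces is innately regular if the family of associated closed linear subspaces is innately regular. Bauschke-Tung constant: for a finite family $\mathcal{B}=(B_i)_{i=1}^m$ of closed affine subspaces let $\mathcal{R}_{\mathcal{B},\lambda}:=\{S:X\to X\,:\,S=(1-\tau)\mathrm{Id}+\tau P_{B},\ \tau\in[0,\lambda],\ B\in\{B_i\,:\,1\le i\le m\}\}$. A known theorem of Bauschke and Tung states that, for $\mathcal{B}$ innately regular and $\lambda\in(0,2)$, there is a constant $\mu_{\mathcal{B},\lambda}>0$,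 depending only on $\mathcal{B}$ and $\lambda$, such that for all $k\in\mathbb{N}$, all $x^0\in X$ and all $S_{k-1},\ldots,S_0\in\mathcal{R}_{\mathcal{B},\lambda}$ one has $\|S_{k-1}S_{k-2}\cdots S_0(x^0)\|\le\|x^0\|+\lambda\mu_{\mathcal{B},\lambda}$. Throughout, $\mu_{\mathcal{B},\lambda}$ denotes a constant with this property. *)

theory Defs
  imports "HOL-Analysis.Analysis"
begin

section \<open>Projections\<close>

text \<open>
  The nearest point is unique when \<open>C\<close> is nonempty, closed and convex in a Hilbert space,
  which is the only case in which this operator is meaningful.  The library's
  \<open>closest_point\<close> is not used because it requires the class \<open>heine_borel\<close>,
  that is, finite dimension.
\<close>

definition proj :: "'a::real_inner set \<Rightarrow> 'a \<Rightarrow> 'a" where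
  "proj C x = (THE p. p \<in> C \<and> (\<forall>y\<in>C. norm (x - p) \<le> norm (x - y)))"

definition relaxed_proj :: "real \<Rightarrow> 'a::real_inner set \<Rightarrow> 'a \<Rightarrow> 'a" where
  "relaxed_proj \<tau> C x = (1 - \<tau>) *\<^sub>R x + \<tau> *\<^sub>R proj C x"


section \<open>Half-spaces and hyperplanes\<close>

text \<open>
  The functional is only required to be linear; its continuity is a consequence
  of the closedness of the set.
\<close>

definition is_halfspace :: "'a::real_inner set \<Rightarrow> bool" where
  "is_halfspace A \<longleftrightarrow>
     (\<exists>(f::'a \<Rightarrow> real) \<alpha>. linear f \<and> f \<noteq> (\<lambda>_. 0) \<and> A = {x. f x \<le> \<alpha>})"

definition is_hyperplane :: "'a::real_inner set \<Rightarrow> bool" where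
  "is_hyperplane A \<longleftrightarrow>
     (\<exists>(f::'a \<Rightarrow> real) \<alpha>. linear f \<and> f \<noteq> (\<lambda>_. 0) \<and> A = {x. f x = \<alpha>})"

definition boundary_hyperplane :: "'a::real_inner set \<Rightarrow> 'a set" where
  "boundary_hyperplane A =
     (THE H. \<exists>(f::'a \<Rightarrow> real) \<alpha>. linear f \<and> f \<noteq> (\<lambda>_. 0) \<and>
        A = {x. f x \<le> \<alpha>} \<and> H = {x. f x = \<alpha>})"

text \<open>The boundary hyperplane does not depend on the functional representing the half-space.\<close>

lemma halfspace_boundary_subset:
  fixes f g :: "'a::real_inner \<Rightarrow> real"
  assumes f: "linear f" "f \<noteq> (\<lambda>_. 0)" and g: "linear g"
    and eq: "{x. f x \<le> \<alpha>} = {x. g x \<le> \<beta>}"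
  shows "{x. f x = \<alpha>} \<subseteq> {x. g x = \<beta>}"
proof
  fix x assume "x \<in> {x. f x = \<alpha>}"
  then have x: "f x = \<alpha>" by simp
  then have le: "g x \<le> \<beta>" using eq by auto
  from f(2) obtain w where w: "f w \<noteq> 0" by auto
  define v where "v = (1 / f w) *\<^sub>R w"
  have v: "f v = 1" using w f(1) by (simp add: v_def linear_scale)
  have "\<not> g x < \<beta>"
  proof
    assume lt: "g x < \<beta>"
    define t where "t = (\<beta> - g x) / (\<bar>g v\<bar> + 1)"
    have t: "t > 0" using lt by (simp add: t_def)
    have "t * g v \<le> t * (\<bar>g v\<bar> + 1)"
      using t by (intro mult_left_mono) auto
    also have "\<dots> = \<beta> - g x" by (simp add: t_def)
    finally have "g (x + t *\<^sub>R v) \<le> \<beta>"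
      using g by (simp add: linear_add linear_scale)
    then have "f (x + t *\<^sub>R v) \<le> \<alpha>" using eq by auto
    then show False using f(1) x v t by (simp add: linear_add linear_scale)
  qed
  with le show "x \<in> {x. g x = \<beta>}" by simp
qed

lemma boundary_hyperplane_eq:
  fixes f :: "'a::real_inner \<Rightarrow> real"
  assumes "linear f" "f \<noteq> (\<lambda>_. 0)"
  shows "boundary_hyperplane {x. f x \<le> \<alpha>} = {x. f x = \<alpha>}"
  unfolding boundary_hyperplane_def
proof (rule the_equality)
  show "\<exists>(g::'a \<Rightarrow> real) \<beta>. linear g \<and> g \<noteq> (\<lambda>_. 0) \<and>
      {x. f x \<le> \<alpha>} = {x. g x \<le> \<beta>} \<and> {x. f x = \<alpha>} = {x. g x = \<beta>}"
    using assms by blast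
next
  fix H
  assume "\<exists>(g::'a \<Rightarrow> real) \<beta>. linear g \<and> g \<noteq> (\<lambda>_. 0) \<and>
      {x. f x \<le> \<alpha>} = {x. g x \<le> \<beta>} \<and> H = {x. g x = \<beta>}"
  then obtain g :: "'a \<Rightarrow> real" and \<beta> where g: "linear g" "g \<noteq> (\<lambda>_. 0)"
    and eq: "{x. f x \<le> \<alpha>} = {x. g x \<le> \<beta>}" and H: "H = {x. g x = \<beta>}"
    by blast
  show "H = {x. f x = \<alpha>}"
    unfolding H
    using halfspace_boundary_subset[OF assms g(1) eq]
      halfspace_boundary_subset[OF g assms(1) eq[symmetric]] by (rule equalityI[rotated])
qed

definition hat :: "'a::real_inner set \<Rightarrow> 'a set" where
  "hat A = (if is_halfspace A then boundary_hyperplane A else A)"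


section \<open>Innate regularity\<close>

definition closed_affine_subspace :: "'a::real_inner set \<Rightarrow> bool" where
  "closed_affine_subspace A \<longleftrightarrow> affine A \<and> A \<noteq> {} \<and> closed A"

text \<open>
  \<open>affine_parallel L A\<close> says that \<open>A\<close> is a translate of \<open>L\<close>; uniqueness of the
  linear subspace \<open>L\<close> is the library's \<open>affine_parallel_subspace\<close>.
\<close>

definition assoc_subspace :: "'a::real_inner set \<Rightarrow> 'a set" where
  "assoc_subspace A = (THE L. subspace L \<and> affine_parallel L A)"

text \<open>
  The next two predicates are intended for finite nonempty (respectively finite)
  index sets and families of closed linear subspaces.
\<close>

definition regular :: "'i set \<Rightarrow> ('i \<Rightarrow> 'a::real_inner set) \<Rightarrow> bool" where
  "regular J L \<longleftrightarrow>
     (\<exists>\<eta>>0. \<forall>x. infdist x (\<Inter>i\<in>J. L i) \<le> \<eta> * Max ((\<lambda>i. infdist x (L i)) ` J))"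

definition innately_regular :: "'i set \<Rightarrow> ('i \<Rightarrow> 'a::real_inner set) \<Rightarrow> bool" where
  "innately_regular I L \<longleftrightarrow> (\<forall>J. J \<subseteq> I \<and> J \<noteq> {} \<longrightarrow> regular J L)"

definition innately_regular_affine :: "'i set \<Rightarrow> ('i \<Rightarrow> 'a::real_inner set) \<Rightarrow> bool" where
  "innately_regular_affine I B \<longleftrightarrow>
     (\<forall>i\<in>I. closed_affine_subspace (B i)) \<and> innately_regular I (\<lambda>i. assoc_subspace (B i))"


section \<open>The Bauschke-Tung constant\<close>

definition relaxations :: "'i set \<Rightarrow> ('i \<Rightarrow> 'a::real_inner set) \<Rightarrow> real \<Rightarrow> ('a \<Rightarrow> 'a) set" where
  "relaxations I B lam = {S. \<exists>\<tau>\<in>{0..lam}. \<exists>i\<in>I. S = relaxed_proj \<tau> (B i)}"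

primrec comp_upto :: "(nat \<Rightarrow> 'a \<Rightarrow> 'a) \<Rightarrow> nat \<Rightarrow> 'a \<Rightarrow> 'a" where
  "comp_upto S 0 = id"
| "comp_upto S (Suc k) = S k \<circ> comp_upto S k"

text \<open>
  The constant is not unique, so it is described by the property characterising it:
  \<open>\<mu>\<close> may be any positive number satisfying the uniform bound, chosen before \<open>k\<close>,
  the starting point and the operators.
\<close>

definition is_BT_constant :: "'i set \<Rightarrow> ('i \<Rightarrow> 'a::real_inner set) \<Rightarrow> real \<Rightarrow> real \<Rightarrow> bool" where
  "is_BT_constant I B lam \<mu> \<longleftrightarrow> \<mu> > 0 \<and>
     (\<forall>k\<ge>1. \<forall>x0 S. (\<forall>j<k. S j \<in> relaxations I B lam) \<longrightarrow>
        norm (comp_upto S k x0) \<le> norm x0 + lam * \<mu>)"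

end

theory Submission
  imports Defs
begin

text \<open>
  Relaxed projection onto a closed half-space is the identity at its points and the relaxed
  projection onto the boundary hyperplane elsewhere.  Replacing the relaxation parameter by \<open>0\<close>
  at the former steps, the orbit becomes an orbit of relaxed projections onto the hyperplanes, to
  which the Bauschke-Tung bound applies.  Innate regularity follows by adding the hyperplanes one
  at a time: a point near all previous hyperplanes is pushed into the new one along a fixed
  direction of their intersection, if there is one transversal to it.
\<close>

section \<open>Projections onto half-spaces and hyperplanes\<close>

text \<open>Midpoints of two almost nearest points stay in \<open>C\<close> by convexity, so the
  parallelogram law forces a minimizing sequence to be Cauchy; completeness and closedness give a
  limit in \<open>C\<close>.\<close>

lemma nearest_point_exists:
  fixes C :: "'a::{real_inner, complete_space} set"
  assumes C: "convex C" "closed C" "C \<noteq> {}"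
  shows "\<exists>p\<in>C. \<forall>y\<in>C. norm (x - p) \<le> norm (x - y)"
proof -
  define d where "d = infdist x C"
  have d0: "0 \<le> d"
    unfolding d_def by (rule infdist_nonneg)
  have dle: "d \<le> norm (x - y)" if "y \<in> C" for y
    using infdist_le[OF that] by (simp add: d_def dist_norm)
  \<comment> \<open>The error is put on the squared distance because the parallelogram law is about
    squares.\<close>
  have "\<exists>y\<in>C. (norm (x - y))\<^sup>2 < d\<^sup>2 + 1 / real (Suc n)" for n
  proof -
    have "d < sqrt (d\<^sup>2 + 1 / real (Suc n))"
      by (rule real_less_rsqrt) simp
    then have "infdist x C < sqrt (d\<^sup>2 + 1 / real (Suc n))"
      by (simp add: d_def)
    then obtain y where y: "y \<in> C" "dist x y < sqrt (d\<^sup>2 + 1 / real (Suc n))"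
      using \<open>C \<noteq> {}\<close> by (auto simp: infdist_def cINF_less_iff)
    have "(dist x y)\<^sup>2 < (sqrt (d\<^sup>2 + 1 / real (Suc n)))\<^sup>2"
      using y(2) by (intro power_strict_mono) auto
    also have "\<dots> = d\<^sup>2 + 1 / real (Suc n)"
      by (rule real_sqrt_pow2) simp
    finally show ?thesis
      using y(1) by (auto simp: dist_norm)
  qed
  then obtain u where u: "\<And>n. u n \<in> C" "\<And>n. (norm (x - u n))\<^sup>2 < d\<^sup>2 + 1 / real (Suc n)"
    by metis
  have close: "(norm (u i - u j))\<^sup>2 \<le> 2 / real (Suc i) + 2 / real (Suc j)" for i j
  proof -
    have "(1/2) *\<^sub>R u i + (1/2) *\<^sub>R u j \<in> C"
      by (rule convexD[OF C(1) u(1) u(1)]) auto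
    from dle[OF this] have "d\<^sup>2 \<le> (norm (x - ((1/2) *\<^sub>R u i + (1/2) *\<^sub>R u j)))\<^sup>2"
      using d0 by (rule power_mono)
    \<comment> \<open>Parallelogram law for \<open>x - u i\<close> and \<open>x - u j\<close>; the
      terms in \<open>d\<close> cancel against the lower bound at the midpoint.\<close>
    moreover have "(norm (u i - u j))\<^sup>2 = 2 * (norm (x - u i))\<^sup>2 + 2 * (norm (x - u j))\<^sup>2
        - 4 * (norm (x - ((1/2) *\<^sub>R u i + (1/2) *\<^sub>R u j)))\<^sup>2"
      by (simp add: power2_norm_eq_inner algebra_simps inner_commute)
    ultimately show ?thesis
      using u(2)[of i] u(2)[of j] by simp
  qed
  have "Cauchy u"
  proof (rule metric_CauchyI)
    fix e :: real assume e: "0 < e"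
    \<comment> \<open>With this \<open>N\<close> each of the two summands in \<open>close\<close>
      stays below half of the squared \<open>e\<close>.\<close>
    obtain N where N: "inverse (real (Suc N)) < e\<^sup>2 / 4"
      using reals_Archimedean[of "e\<^sup>2 / 4"] e by auto
    have "dist (u i) (u j) < e" if "N \<le> i" "N \<le> j" for i j
    proof -
      have "1 / real (Suc i) \<le> inverse (real (Suc N))" "1 / real (Suc j) \<le> inverse (real (Suc N))"
        using that by (simp_all add: field_simps)
      then have "(norm (u i - u j))\<^sup>2 < e\<^sup>2"
        using close[of i j] N by simp
      then show ?thesis
        using e by (simp add: dist_norm power2_less_imp_less)
    qed
    then show "\<exists>M. \<forall>i\<ge>M. \<forall>j\<ge>M. dist (u i) (u j) < e" by blast
  qed
  then obtain p where p: "u \<longlonglongrightarrow> p"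
    by (auto simp: Cauchy_convergent_iff convergent_def)
  have "p \<in> C"
    using closed_sequentially[OF C(2)] u(1) p by blast
  have "(norm (x - p))\<^sup>2 \<le> d\<^sup>2 + 0"
  proof (rule LIMSEQ_le)
    show "(\<lambda>n. (norm (x - u n))\<^sup>2) \<longlonglongrightarrow> (norm (x - p))\<^sup>2"
      by (intro tendsto_intros p)
    show "(\<lambda>n. d\<^sup>2 + 1 / real (Suc n)) \<longlonglongrightarrow> d\<^sup>2 + 0"
      using LIMSEQ_inverse_real_of_nat
      by (intro tendsto_add tendsto_const) (simp add: inverse_eq_divide)
    show "\<exists>N. \<forall>n\<ge>N. (norm (x - u n))\<^sup>2 \<le> d\<^sup>2 + 1 / real (Suc n)"
      using u(2) less_imp_le by blast
  qed
  then have "norm (x - p) \<le> d"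
    using d0 by (auto intro: power2_le_imp_le)
  then have "norm (x - p) \<le> norm (x - y)" if "y \<in> C" for y
    using dle[OF that] by (rule order_trans)
  with \<open>p \<in> C\<close> show ?thesis by blast
qed

section \<open>Closed hyperplanes and normal vectors\<close>

text \<open>The point reflection in a point \<open>p\<close> of the hyperplane swaps the half-space
  with the opposite one. The hyperplane is the intersection of the two, and the reflection is
  continuous although \<open>f\<close> is not yet known to be.\<close>

lemma closed_hyperplane_of_closed_halfspace:
  fixes f :: "'a::real_inner \<Rightarrow> real"
  assumes f: "linear f" and cl: "closed {x. f x \<le> \<alpha>}"
  shows "closed {x. f x = \<alpha>}"
proof (cases "\<exists>p. f p = \<alpha>")
  case True
  then obtain p where p: "f p = \<alpha>" by blast
  have "{x. f x = \<alpha>} = {x. f x \<le> \<alpha>} \<inter> (\<lambda>x. 2 *\<^sub>R p - x) -` {x. f x \<le> \<alpha>}"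
    using p f by (auto simp: linear_diff linear_scale)
  moreover have "closed ((\<lambda>x. 2 *\<^sub>R p - x) -` {x. f x \<le> \<alpha>})"
    by (intro closed_vimage cl continuous_intros)
  ultimately show ?thesis
    using cl by (simp add: closed_Int)
qed simp

text \<open>
  A nearest point of the hyperplane to an outer point gives a normal vector.
\<close>

lemma riesz_of_closed_hyperplane:
  fixes f :: "'a::{real_inner, complete_space} \<Rightarrow> real"
  assumes f: "linear f" "f \<noteq> (\<lambda>_. 0)" and cl: "closed {x. f x = \<alpha>}"
  shows "\<exists>a. a \<noteq> 0 \<and> f = inner a"
proof -
  let ?H = "{x. f x = \<alpha>}"
  obtain v where v: "f v \<noteq> 0" using f(2) by auto
  \<comment> \<open>The level of \<open>w\<close> is chosen one above that of the hyperplane, so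
    that the normal \<open>b\<close> below satisfies \<open>f b = 1\<close>.\<close>
  have p0: "f ((\<alpha> / f v) *\<^sub>R v) = \<alpha>" and w: "f (((\<alpha> + 1) / f v) *\<^sub>R v) = \<alpha> + 1"
    using v by (simp_all add: linear_scale[OF f(1)])
  define w where "w = ((\<alpha> + 1) / f v) *\<^sub>R v"
  have "convex ?H"
    by (auto simp: convex_def linear_add[OF f(1)] linear_scale[OF f(1)] simp flip: distrib_right)
  with cl p0 obtain p where p: "f p = \<alpha>" "\<And>y. f y = \<alpha> \<Longrightarrow> norm (w - p) \<le> norm (w - y)"
    using nearest_point_exists[of ?H w] by blast
  define b where "b = w - p"
  have fb: "f b = 1"
    using w p(1) by (simp add: b_def w_def linear_diff[OF f(1)])
  have b0: "b \<noteq> 0"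
    using fb linear_0[OF f(1)] by auto
  \<comment> \<open>Moving \<open>p\<close> along the kernel of \<open>f\<close> stays in the
    hyperplane. The multiple \<open>?t\<close> minimizes the distance along \<open>z\<close> and
    would strictly improve on \<open>p\<close> if \<open>b\<close> were not orthogonal to
    \<open>z\<close>.\<close>
  have orth: "inner b z = 0" if z: "f z = 0" for z
  proof (rule ccontr)
    assume nz: "inner b z \<noteq> 0"
    then have zz: "0 < inner z z" by auto
    let ?t = "inner b z / inner z z"
    have "f (p + ?t *\<^sub>R z) = \<alpha>"
      using p(1) z by (simp add: linear_add[OF f(1)] linear_scale[OF f(1)])
    from p(2)[OF this] have "norm b \<le> norm (b - ?t *\<^sub>R z)"
      by (simp add: b_def algebra_simps)
    then have "(norm b)\<^sup>2 \<le> (norm (b - ?t *\<^sub>R z))\<^sup>2"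
      by (rule power_mono) simp
    also have "\<dots> = (norm b)\<^sup>2 - 2 * (?t * inner b z) + ?t * (?t * inner z z)"
      unfolding power2_norm_eq_inner by (simp add: inner_diff inner_commute)
    also have "\<dots> = (norm b)\<^sup>2 - (inner b z)\<^sup>2 / inner z z"
      using zz by (simp add: power2_eq_square)
    finally have "(inner b z)\<^sup>2 / inner z z \<le> 0" by simp
    moreover have "0 < (inner b z)\<^sup>2 / inner z z"
      using nz zz by (intro divide_pos_pos) simp_all
    ultimately show False by linarith
  qed
  \<comment> \<open>Since \<open>f b = 1\<close>, subtracting \<open>f x\<close> times
    \<open>b\<close> from \<open>x\<close> lands in the kernel, to which \<open>b\<close> is
    orthogonal.\<close>
  have "f x = inner ((1 / inner b b) *\<^sub>R b) x" for x
  proof -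
    have "inner b (x - f x *\<^sub>R b) = 0"
      by (rule orth) (simp add: linear_diff[OF f(1)] linear_scale[OF f(1)] fb)
    then show ?thesis
      using b0 by (simp add: inner_diff_right field_simps)
  qed
  then show ?thesis
    using b0 by (intro exI[of _ "(1 / inner b b) *\<^sub>R b"]) auto
qed

section \<open>Evaluating projections\<close>

text \<open>The obtuse angle condition yields the Pythagorean inequality \<open>pyth\<close>, which
  gives both minimality of \<open>p\<close> and the uniqueness that the definite description in
  \<open>proj\<close> requires.\<close>

lemma proj_eqI:
  fixes p :: "'a::real_inner"
  assumes p: "p \<in> C" and obtuse: "\<And>y. y \<in> C \<Longrightarrow> inner (x - p) (y - p) \<le> 0"
  shows "proj C x = p"
proof -
  have pyth: "(norm (x - p))\<^sup>2 + (norm (y - p))\<^sup>2 \<le> (norm (x - y))\<^sup>2" if "y \<in> C" for y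
    using obtuse[OF that] by (simp add: power2_norm_eq_inner algebra_simps inner_commute)
  show ?thesis
    unfolding proj_def
  proof (rule the_equality)
    have "norm (x - p) \<le> norm (x - y)" if "y \<in> C" for y
    proof (rule power2_le_imp_le)
      show "(norm (x - p))\<^sup>2 \<le> (norm (x - y))\<^sup>2"
        using pyth[OF that] zero_le_power2[of "norm (y - p)"] by linarith
    qed simp
    with p show "p \<in> C \<and> (\<forall>y\<in>C. norm (x - p) \<le> norm (x - y))" by blast
  next
    fix q assume q: "q \<in> C \<and> (\<forall>y\<in>C. norm (x - q) \<le> norm (x - y))"
    then have "(norm (x - q))\<^sup>2 \<le> (norm (x - p))\<^sup>2"
      using p by (intro power_mono) auto
    moreover have "(norm (x - p))\<^sup>2 + (norm (q - p))\<^sup>2 \<le> (norm (x - q))\<^sup>2"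
      using pyth q by blast
    ultimately have "(norm (q - p))\<^sup>2 \<le> 0" by linarith
    then show "q = p" by simp
  qed
qed

lemma proj_hyperplane:
  fixes a :: "'a::real_inner"
  assumes "a \<noteq> 0"
  shows "proj {x. inner a x = \<alpha>} x = x - ((inner a x - \<alpha>) / inner a a) *\<^sub>R a" (is "_ = ?p")
proof (rule proj_eqI)
  show p: "?p \<in> {x. inner a x = \<alpha>}"
    using assms by (simp add: inner_diff_right)
  fix y assume "y \<in> {x. inner a x = \<alpha>}"
  with p have "inner a (y - ?p) = 0"
    unfolding inner_diff_right[of a y] by simp
  then show "inner (x - ?p) (y - ?p) \<le> 0" by simp
qed

text \<open>The vector from the foot on the hyperplane to \<open>x\<close> is a nonnegative multiple
  of the outer normal \<open>a\<close>, so it makes no acute angle with a direction into the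
  half-space.\<close>

lemma proj_halfspace_outside:
  fixes a :: "'a::real_inner"
  assumes a: "a \<noteq> 0" and x: "\<alpha> < inner a x"
  shows "proj {x. inner a x \<le> \<alpha>} x = proj {x. inner a x = \<alpha>} x"
proof -
  let ?p = "x - ((inner a x - \<alpha>) / inner a a) *\<^sub>R a"
  have p: "inner a ?p = \<alpha>"
    using a by (simp add: inner_diff_right)
  have "proj {x. inner a x \<le> \<alpha>} x = ?p"
  proof (rule proj_eqI)
    fix y assume "y \<in> {x. inner a x \<le> \<alpha>}"
    with p have "inner a (y - ?p) \<le> 0"
      unfolding inner_diff_right[of a y] by simp
    moreover have "0 \<le> (inner a x - \<alpha>) / inner a a"
      using x by simp
    ultimately have "(inner a x - \<alpha>) / inner a a * inner a (y - ?p) \<le> 0"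
      by (rule mult_nonneg_nonpos[rotated])
    then show "inner (x - ?p) (y - ?p) \<le> 0" by simp
  qed (use p in simp)
  then show ?thesis
    by (simp only: proj_hyperplane[OF a])
qed

text \<open>Puts both kinds of set into one form with a common normal vector for the set and its
  \<open>hat\<close>; the case split is the one in \<open>hat\<close>.\<close>

lemma halfspace_or_hyperplane_normal:
  fixes A :: "'a::{real_inner, complete_space} set"
  assumes "closed A" "is_halfspace A \<or> is_hyperplane A"
  obtains a \<alpha> where "a \<noteq> 0" "hat A = {x. inner a x = \<alpha>}"
    "A = {x. inner a x \<le> \<alpha>} \<or> A = {x. inner a x = \<alpha>}"
proof (cases "is_halfspace A")
  case True
  then obtain f :: "'a \<Rightarrow> real" and \<alpha> where f: "linear f" "f \<noteq> (\<lambda>_. 0)" and A: "A = {x. f x \<le> \<alpha>}"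
    by (auto simp: is_halfspace_def)
  obtain a where a: "a \<noteq> 0" "f = inner a"
    using riesz_of_closed_hyperplane[OF f closed_hyperplane_of_closed_halfspace[OF f(1)]] assms(1) A
    by blast
  have "hat A = {x. f x = \<alpha>}"
    using True boundary_hyperplane_eq[OF f, of \<alpha>] by (simp add: hat_def A)
  with a A that show ?thesis by blast
next
  case False
  with assms(2) obtain f :: "'a \<Rightarrow> real" and \<alpha>
    where f: "linear f" "f \<noteq> (\<lambda>_. 0)" and A: "A = {x. f x = \<alpha>}"
    by (auto simp: is_hyperplane_def)
  obtain a where "a \<noteq> 0" "f = inner a"
    using riesz_of_closed_hyperplane[OF f] assms(1) A by blast
  with False A that show ?thesis by (auto simp: hat_def)
qed

text \<open>A point of \<open>A\<close> is fixed, which is the choice 0; outside \<open>A\<close>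
  the two projections agree, which is the choice \<open>t\<close>. The parameter \<open>s\<close>
  depends on \<open>x\<close>, so the agreement is pointwise, which is enough along a single
  orbit.\<close>

lemma relaxed_proj_eq_hat:
  fixes A :: "'a::{real_inner, complete_space} set"
  assumes "closed A" "is_halfspace A \<or> is_hyperplane A"
  shows "\<exists>s\<in>{0, t}. relaxed_proj t A x = relaxed_proj s (hat A) x"
proof -
  obtain a \<alpha> where a: "a \<noteq> 0" and hat: "hat A = {x. inner a x = \<alpha>}"
    and A: "A = {x. inner a x \<le> \<alpha>} \<or> A = {x. inner a x = \<alpha>}"
    using assms by (rule halfspace_or_hyperplane_normal)
  show ?thesis
  proof (cases "x \<in> A")
    case True
    then have "proj A x = x"
      by (intro proj_eqI) auto
    then have "relaxed_proj t A x = relaxed_proj 0 (hat A) x"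
      by (simp add: relaxed_proj_def algebra_simps)
    then show ?thesis by blast
  next
    case False
    with A have "proj A x = proj (hat A) x"
      using proj_halfspace_outside[OF a, of \<alpha> x] by (auto simp: hat)
    then show ?thesis by (simp add: relaxed_proj_def)
  qed
qed


section \<open>Innate regularity of hyperplanes\<close>

text \<open>An error bound for homogeneous linear equations, by induction on their number. A witness
  \<open>y\<close> instead of a distance lets the induction step correct an exact solution of the
  earlier equations.\<close>

lemma hoffman_bound_hyperplanes:
  fixes a :: "'i \<Rightarrow> 'a::real_inner"
  assumes "finite J"
  shows "\<exists>\<eta>\<ge>0. \<forall>x. \<exists>y. (\<forall>i\<in>J. inner (a i) y = 0) \<and> norm (x - y) \<le> \<eta> * (\<Sum>i\<in>J. \<bar>inner (a i) x\<bar>)"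
  using assms
proof (induction J rule: finite_induct)
  case empty
  show ?case by (auto intro!: exI[of _ 0])
next
  case (insert j J)
  let ?S = "\<lambda>x. \<Sum>i\<in>J. \<bar>inner (a i) x\<bar>"
  obtain \<eta> where \<eta>: "\<eta> \<ge> 0"
    "\<And>x. \<exists>y. (\<forall>i\<in>J. inner (a i) y = 0) \<and> norm (x - y) \<le> \<eta> * ?S x"
    using insert.IH by blast
  have S0: "0 \<le> ?S x" for x by (intro sum_nonneg) simp
  show ?case
  proof (cases "\<exists>v. (\<forall>i\<in>J. inner (a i) v = 0) \<and> inner (a j) v \<noteq> 0")
    case True
    then obtain v where v: "\<forall>i\<in>J. inner (a i) v = 0" "inner (a j) v \<noteq> 0" by blast
    define K where "K = norm v / \<bar>inner (a j) v\<bar>"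
    have K: "K \<ge> 0" by (simp add: K_def)
    \<comment> \<open>The first \<open>\<eta>\<close> pays for moving from \<open>x\<close> to
      \<open>y\<close>, the rest for the correction along \<open>v\<close>: it costs
      \<open>K\<close> times the residual of \<open>y\<close>, which exceeds that of
      \<open>x\<close> by at most \<open>norm (a j)\<close> times the distance from \<open>x\<close>
      to \<open>y\<close>.\<close>
    let ?\<theta> = "\<eta> + K * (1 + norm (a j) * \<eta>)"
    have "\<exists>y. (\<forall>i\<in>insert j J. inner (a i) y = 0) \<and>
        norm (x - y) \<le> ?\<theta> * (\<Sum>i\<in>insert j J. \<bar>inner (a i) x\<bar>)" for x
    proof -
      obtain y where y: "\<forall>i\<in>J. inner (a i) y = 0" "norm (x - y) \<le> \<eta> * ?S x"
        using \<eta>(2) by blast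
      \<comment> \<open>Moving along \<open>v\<close> preserves the equations in \<open>J\<close>,
        and this multiple solves the new one.\<close>
      define z where "z = y - (inner (a j) y / inner (a j) v) *\<^sub>R v"
      have z: "\<forall>i\<in>insert j J. inner (a i) z = 0"
        using y v by (auto simp: z_def inner_diff_right)
      have "\<bar>inner (a j) y\<bar> \<le> \<bar>inner (a j) x\<bar> + \<bar>inner (a j) (x - y)\<bar>"
        by (simp add: inner_diff_right)
      also have "\<bar>inner (a j) (x - y)\<bar> \<le> norm (a j) * norm (x - y)"
        by (rule Cauchy_Schwarz_ineq2)
      also have "\<dots> \<le> norm (a j) * (\<eta> * ?S x)"
        using y(2) by (rule mult_left_mono) simp
      finally have ay: "\<bar>inner (a j) y\<bar> \<le> \<bar>inner (a j) x\<bar> + norm (a j) * (\<eta> * ?S x)" by simp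
      have "norm (x - z) = norm ((x - y) + (inner (a j) y / inner (a j) v) *\<^sub>R v)"
        by (simp add: z_def algebra_simps)
      also have "\<dots> \<le> norm (x - y) + norm ((inner (a j) y / inner (a j) v) *\<^sub>R v)"
        by (rule norm_triangle_ineq)
      also have "\<dots> = norm (x - y) + K * \<bar>inner (a j) y\<bar>"
        by (simp add: K_def)
      also have "\<dots> \<le> \<eta> * ?S x + K * (\<bar>inner (a j) x\<bar> + norm (a j) * (\<eta> * ?S x))"
        using y(2) ay K by (intro add_mono mult_left_mono)
      also have "\<dots> \<le> ?\<theta> * (\<bar>inner (a j) x\<bar> + ?S x)"
      proof -
        have "0 \<le> (\<eta> + K * (norm (a j) * \<eta>)) * \<bar>inner (a j) x\<bar> + K * ?S x"
          using \<eta>(1) K S0 by (intro add_nonneg_nonneg mult_nonneg_nonneg) auto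
        then show ?thesis by (simp add: algebra_simps)
      qed
      finally show ?thesis
        using z insert.hyps by (intro exI[of _ z]) simp
    qed
    moreover have "?\<theta> \<ge> 0"
      using \<eta>(1) K by simp
    ultimately show ?thesis by blast
  next
    case False
    \<comment> \<open>The new equation now follows from the earlier ones, so the old witness and the
      old constant remain valid.\<close>
    have "\<exists>y. (\<forall>i\<in>insert j J. inner (a i) y = 0) \<and>
        norm (x - y) \<le> \<eta> * (\<Sum>i\<in>insert j J. \<bar>inner (a i) x\<bar>)" for x
    proof -
      obtain y where y: "\<forall>i\<in>J. inner (a i) y = 0" "norm (x - y) \<le> \<eta> * ?S x"
        using \<eta>(2) by blast
      note y(2)
      also have "\<eta> * ?S x \<le> \<eta> * (\<Sum>i\<in>insert j J. \<bar>inner (a i) x\<bar>)"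
        using \<eta>(1) insert.hyps by (intro mult_left_mono) auto
      finally show ?thesis
        using y(1) False by blast
    qed
    with \<eta>(1) show ?thesis by blast
  qed
qed

text \<open>Cauchy-Schwarz applied to \<open>x - z\<close> for each \<open>z\<close> in the kernel.
  This turns the residuals of the error bound into distances.\<close>

lemma abs_inner_le_infdist:
  fixes a :: "'a::real_inner"
  shows "\<bar>inner a x\<bar> \<le> norm a * infdist x {z. inner a z = 0}"
proof (cases "a = 0")
  case False
  have "\<bar>inner a x\<bar> / norm a \<le> infdist x {z. inner a z = 0}"
  proof -
    have ne: "{z. inner a z = 0} \<noteq> {}"
      using inner_zero_right by blast
    have "\<bar>inner a x\<bar> / norm a \<le> dist x z" if "inner a z = 0" for z
    proof -
      have "\<bar>inner a x\<bar> = \<bar>inner a (x - z)\<bar>"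
        using that by (simp add: inner_diff_right)
      also have "\<dots> \<le> norm a * norm (x - z)"
        by (rule Cauchy_Schwarz_ineq2)
      finally show ?thesis
        using False by (simp add: dist_norm divide_simps mult.commute)
    qed
    then show ?thesis
      using ne by (auto simp: infdist_notempty intro!: cINF_greatest)
  qed
  then show ?thesis
    using False by (simp add: divide_simps mult.commute)
qed simp

lemma regular_hyperplanes:
  fixes a :: "'i \<Rightarrow> 'a::real_inner"
  assumes J: "finite J" "J \<noteq> {}"
  shows "regular J (\<lambda>i. {x. inner (a i) x = 0})"
proof -
  let ?L = "\<lambda>i. {x. inner (a i) x = 0}"
  obtain \<eta> where \<eta>: "\<eta> \<ge> 0"
    "\<And>x. \<exists>y. (\<forall>i\<in>J. inner (a i) y = 0) \<and> norm (x - y) \<le> \<eta> * (\<Sum>i\<in>J. \<bar>inner (a i) x\<bar>)"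
    using hoffman_bound_hyperplanes[OF J(1), of a] by blast
  \<comment> \<open>This constant may be 0, while \<open>regular\<close> demands a positive one;
    hence the added 1 below.\<close>
  let ?\<theta> = "\<eta> * (\<Sum>i\<in>J. norm (a i))"
  have "infdist x (\<Inter>i\<in>J. ?L i) \<le> (?\<theta> + 1) * Max ((\<lambda>i. infdist x (?L i)) ` J)" for x
  proof -
    let ?M = "Max ((\<lambda>i. infdist x (?L i)) ` J)"
    have le: "infdist x (?L i) \<le> ?M" if "i \<in> J" for i
      using J(1) that by (intro Max_ge) auto
    then have M0: "0 \<le> ?M"
      using J(2) infdist_nonneg by (meson all_not_in_conv order_trans)
    obtain y where y: "\<forall>i\<in>J. inner (a i) y = 0" "norm (x - y) \<le> \<eta> * (\<Sum>i\<in>J. \<bar>inner (a i) x\<bar>)"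
      using \<eta>(2) by blast
    have "infdist x (\<Inter>i\<in>J. ?L i) \<le> dist x y"
      using y(1) by (intro infdist_le) simp
    also have "\<dots> \<le> \<eta> * (\<Sum>i\<in>J. \<bar>inner (a i) x\<bar>)"
      using y(2) by (simp add: dist_norm)
    also have "\<dots> \<le> \<eta> * (\<Sum>i\<in>J. norm (a i) * ?M)"
    proof (intro mult_left_mono sum_mono \<eta>(1))
      fix i assume "i \<in> J"
      have "norm (a i) * infdist x (?L i) \<le> norm (a i) * ?M"
        using le[OF \<open>i \<in> J\<close>] by (rule mult_left_mono) simp
      with abs_inner_le_infdist[of "a i" x] show "\<bar>inner (a i) x\<bar> \<le> norm (a i) * ?M" by linarith
    qed
    also have "\<dots> \<le> (?\<theta> + 1) * ?M"
      using M0 by (simp add: distrib_right sum_distrib_right mult.assoc)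
    finally show ?thesis .
  qed
  moreover have "?\<theta> + 1 > 0"
    using \<eta>(1) by (simp add: sum_nonneg add_nonneg_pos)
  ultimately show ?thesis
    unfolding regular_def by blast
qed

section \<open>Hyperplanes as affine subspaces\<close>

lemma closed_affine_subspace_hyperplane:
  fixes a :: "'a::real_inner"
  assumes "a \<noteq> 0"
  shows "closed_affine_subspace {x. inner a x = \<alpha>}"
proof -
  have "inner a ((\<alpha> / inner a a) *\<^sub>R a) = \<alpha>"
    using assms by simp
  then have "{x. inner a x = \<alpha>} \<noteq> {}" by blast
  moreover have "affine {x. inner a x = \<alpha>}"
    by (auto simp: affine_def inner_add_right simp flip: distrib_right)
  ultimately show ?thesis
    by (simp add: closed_affine_subspace_def closed_hyperplane)
qed

text \<open>Translation by \<open>?p\<close> carries the kernel onto the hyperplane. The library's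
  uniqueness statement has the arguments of \<open>affine_parallel\<close> in the other order, so
  symmetry is used to evaluate the definite description.\<close>

lemma assoc_subspace_hyperplane:
  fixes a :: "'a::real_inner"
  assumes "a \<noteq> 0"
  shows "assoc_subspace {x. inner a x = \<alpha>} = {x. inner a x = 0}"
proof -
  let ?H = "{x. inner a x = \<alpha>}"
  let ?p = "(\<alpha> / inner a a) *\<^sub>R a"
  have p: "inner a ?p = \<alpha>"
    using assms by simp
  have "?H = (+) ?p ` {x. inner a x = 0}"
  proof (intro equalityI subsetI)
    fix x assume "x \<in> ?H"
    then have "x = ?p + (x - ?p)" "inner a (x - ?p) = 0"
      using p by (simp_all add: inner_diff_right)
    then show "x \<in> (+) ?p ` {x. inner a x = 0}" by blast
  qed (use p in \<open>auto simp: inner_add_right\<close>)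
  then have ex: "subspace {x. inner a x = 0} \<and> affine_parallel {x. inner a x = 0} ?H"
    by (auto simp: affine_parallel_def subspace_hyperplane)
  have unique: "\<exists>!L. subspace L \<and> affine_parallel ?H L"
    using closed_affine_subspace_hyperplane[OF assms, of \<alpha>]
    by (intro affine_parallel_subspace) (simp_all add: closed_affine_subspace_def)
  show ?thesis
    unfolding assoc_subspace_def
  proof (rule the_equality)
    show "subspace {x. inner a x = 0} \<and> affine_parallel {x. inner a x = 0} ?H"
      by (rule ex)
  next
    fix L assume "subspace L \<and> affine_parallel L ?H"
    then have "subspace L \<and> affine_parallel ?H L"
      using affine_parallel_commute by blast
    moreover have "subspace {x. inner a x = 0} \<and> affine_parallel ?H {x. inner a x = 0}"
      using ex affine_parallel_commute by blast
    ultimately show "L = {x. inner a x = 0}"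
      using unique by blast
  qed
qed

text \<open>Every subfamily of the associated subspaces is again a finite family of kernels, so one
  regularity lemma serves all \<open>J\<close>.\<close>

lemma innately_regular_affine_hyperplanes:
  fixes a :: "'i \<Rightarrow> 'a::real_inner"
  assumes "finite I" and B: "\<And>i. i \<in> I \<Longrightarrow> a i \<noteq> 0 \<and> B i = {x. inner (a i) x = \<alpha> i}"
  shows "innately_regular_affine I B"
proof -
  have "regular J (\<lambda>i. assoc_subspace (B i))" if J: "J \<subseteq> I" "J \<noteq> {}" for J
  proof -
    have L: "assoc_subspace (B i) = {x. inner (a i) x = 0}" if "i \<in> J" for i
      using B[of i] J(1) that assoc_subspace_hyperplane[of "a i" "\<alpha> i"] by auto
    have "(\<Inter>i\<in>J. assoc_subspace (B i)) = (\<Inter>i\<in>J. {x. inner (a i) x = 0})"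
      and "(\<lambda>i. infdist x (assoc_subspace (B i))) ` J = (\<lambda>i. infdist x {x. inner (a i) x = 0}) ` J" for x
      using L by (auto intro!: image_cong)
    moreover have "regular J (\<lambda>i. {x. inner (a i) x = 0})"
      using J \<open>finite I\<close> by (intro regular_hyperplanes) (auto intro: finite_subset)
    ultimately show ?thesis
      by (simp only: regular_def)
  qed
  moreover have "closed_affine_subspace (B i)" if "i \<in> I" for i
    using B[OF that] closed_affine_subspace_hyperplane[of "a i" "\<alpha> i"] by simp
  ultimately show ?thesis
    by (simp add: innately_regular_affine_def innately_regular_def)
qed

section \<open>The bound\<close>

lemma comp_upto_eq_orbit:
  assumes "\<And>k. x (Suc k) = S k (x k)"
  shows "comp_upto S k (x 0) = x k"
  by (induction k) (simp_all add: assms)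

theorem theorem4:
  fixes A :: "nat \<Rightarrow> 'a::{real_inner, complete_space} set"
    and m :: nat and lam :: real
  assumes "(UNIV :: 'a set) \<noteq> {0}"
    and "m \<ge> 1"
    and "0 < lam" and "lam < 2"
    and "\<And>i. i \<in> {1..m} \<Longrightarrow> closed (A i) \<and> (is_halfspace (A i) \<or> is_hyperplane (A i))"
  shows "innately_regular_affine {1..m} (\<lambda>i. hat (A i)) \<and>
    (\<forall>\<mu>. is_BT_constant {1..m} (\<lambda>i. hat (A i)) lam \<mu> \<longrightarrow>
      (\<forall>(l :: nat \<Rightarrow> real) (c :: nat \<Rightarrow> nat) (x :: nat \<Rightarrow> 'a).
        (\<forall>k. l k \<in> {0..lam}) \<longrightarrow>
        (\<forall>k. c k \<in> {1..m}) \<longrightarrow>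
        (\<forall>k. x (Suc k) = relaxed_proj (l k) (A (c k)) (x k)) \<longrightarrow>
        (\<forall>k. norm (x k) \<le> norm (x 0) + lam * \<mu>)))"
proof (intro conjI allI impI)
  have "\<forall>i\<in>{1..m}. \<exists>a \<alpha>. a \<noteq> 0 \<and> hat (A i) = {x. inner a x = \<alpha>}"
    using assms(5) by (metis halfspace_or_hyperplane_normal)
  then obtain a \<alpha> where "\<forall>i\<in>{1..m}. a i \<noteq> 0 \<and> hat (A i) = {x. inner (a i) x = \<alpha> i}"
    by metis
  then show "innately_regular_affine {1..m} (\<lambda>i. hat (A i))"
    by (intro innately_regular_affine_hyperplanes[where a = a and \<alpha> = \<alpha>]) auto
next
  fix \<mu> and l :: "nat \<Rightarrow> real" and c :: "nat \<Rightarrow> nat" and x :: "nat \<Rightarrow> 'a" and k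
  assume BT: "is_BT_constant {1..m} (\<lambda>i. hat (A i)) lam \<mu>"
    and l: "\<forall>k. l k \<in> {0..lam}" and c: "\<forall>k. c k \<in> {1..m}"
    and x: "\<forall>k. x (Suc k) = relaxed_proj (l k) (A (c k)) (x k)"
  have "\<exists>s\<in>{0, l k}. x (Suc k) = relaxed_proj s (hat (A (c k))) (x k)" for k
    using relaxed_proj_eq_hat[of "A (c k)" "l k" "x k"] assms(5) c x by metis
  then obtain s where s: "\<And>k. s k \<in> {0, l k}"
    "\<And>k. x (Suc k) = relaxed_proj (s k) (hat (A (c k))) (x k)"
    by metis
  \<comment> \<open>These operators are built from the orbit itself. This is legitimate because the
    bound in \<open>is_BT_constant\<close> is uniform over all choices of operators.\<close>
  define S where "S k = relaxed_proj (s k) (hat (A (c k)))" for k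
  have "s k \<in> {0..lam}" for k
    using s(1)[of k] l assms(3) by (metis atLeastAtMost_iff empty_iff insert_iff less_imp_le order_refl)
  then have "S k \<in> relaxations {1..m} (\<lambda>i. hat (A i)) lam" for k
    using c unfolding relaxations_def S_def by blast
  moreover have "comp_upto S k (x 0) = x k" for k
    using s(2) by (intro comp_upto_eq_orbit) (simp add: S_def)
  \<comment> \<open>The Bauschke-Tung property speaks only of at least one factor; the case of no
    factor rests on the sign of \<open>lam * \<mu>\<close>.\<close>
  ultimately have "norm (x k) \<le> norm (x 0) + lam * \<mu>" if "k \<ge> 1"
    using BT that unfolding is_BT_constant_def by metis
  moreover have "0 \<le> lam * \<mu>"
    using BT assms(3) by (simp add: is_BT_constant_def)
  ultimately show "norm (x k) \<le> norm (x 0) + lam * \<mu>"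
    by (cases k) auto
qed

end
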